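(* Let $\lambda$, $\mu$ and $\nu$ be fixed partitions. Then for every integer $k\ge 1$, $$K_{k\lambda/k\mu,\,k\nu}>0 \iff K_{\lambda/\mu,\,\nu}>0 .$$
   Context: For partitions $\lambda,\mu$ and $\nu=(\nu_1,\nu_2,\dots)$, the skew Kostka number $K_{\lambda/\mu,\nu}$ is the number of semistandard Young tableaux of skew shape $\lambda/\mu$ (rows weakly increasing, columns strictly increasing) and type $\nu$, i.e. in which exactly $\nu_i$ boxes have content $i$ for each $i$. (It is $0$ if no such tableau exists, in particular if $\mu\not\subseteq\lambda$ or $|\lambda|-|\mu|\ne|\nu|$.) For a positive integer $k$, $k\lambda$ denotes the partition obtained by multiplying every part of $\lambda$ by $k$. *)

theory Defs
  imports Main "HOL-Library.FuncSet"
begin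

text \<open>
  A partition is a weakly decreasing sequence of natural numbers with finitely many nonzero
  terms. Rows, columns and parts are numbered from 0, so \<open>p i\<close> is the part usually
  called number \<open>i + 1\<close>; tableau entries, in contrast, are positive integers.
\<close>

definition is_partition :: "(nat \<Rightarrow> nat) \<Rightarrow> bool" where
  "is_partition p \<longleftrightarrow> antimono p \<and> finite {i. p i \<noteq> 0}"

definition scale_partition :: "nat \<Rightarrow> (nat \<Rightarrow> nat) \<Rightarrow> nat \<Rightarrow> nat" where
  "scale_partition k p = (\<lambda>i. k * p i)"

definition skew_diagram :: "(nat \<Rightarrow> nat) \<Rightarrow> (nat \<Rightarrow> nat) \<Rightarrow> (nat \<times> nat) set" where
  "skew_diagram l m = {(i, j). m i \<le> j \<and> j < l i}"

text \<open>
  Tableaux are extensional functions (undefined outside the diagram), so that two of them are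
  equal iff they agree on the diagram. If \<open>m\<close> is not contained in \<open>l\<close>, then
  \<open>l/m\<close> is not a shape and there are no tableaux. The last condition also fixes the
  number of boxes, as every entry is of the form \<open>Suc i\<close>.
\<close>

definition skew_ssyt ::
  "(nat \<Rightarrow> nat) \<Rightarrow> (nat \<Rightarrow> nat) \<Rightarrow> (nat \<Rightarrow> nat) \<Rightarrow> (nat \<times> nat \<Rightarrow> nat) set" where
  "skew_ssyt l m n = {T \<in> skew_diagram l m \<rightarrow>\<^sub>E {1..}.
     (\<forall>i. m i \<le> l i) \<and>
     (\<forall>i j j'. (i, j) \<in> skew_diagram l m \<longrightarrow> (i, j') \<in> skew_diagram l m \<longrightarrow> j < j'
        \<longrightarrow> T (i, j) \<le> T (i, j')) \<and>
     (\<forall>i i' j. (i, j) \<in> skew_diagram l m \<longrightarrow> (i', j) \<in> skew_diagram l m \<longrightarrow> i < i'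
        \<longrightarrow> T (i, j) < T (i', j)) \<and>
     (\<forall>i. card {b \<in> skew_diagram l m. T b = Suc i} = n i)}"

definition skew_kostka :: "(nat \<Rightarrow> nat) \<Rightarrow> (nat \<Rightarrow> nat) \<Rightarrow> (nat \<Rightarrow> nat) \<Rightarrow> nat" where
  "skew_kostka l m n = card (skew_ssyt l m n)"

lemma finite_skew_diagram:
  assumes "is_partition l"
  shows "finite (skew_diagram l m)"
proof -
  have "skew_diagram l m \<subseteq> (SIGMA i:{i. l i \<noteq> 0}. {..<l i})"
    by (auto simp: skew_diagram_def)
  then show ?thesis
    using assms by (rule_tac finite_subset) (auto simp: is_partition_def)
qed

text \<open>The cardinality above is a genuine count, since the set of tableaux is finite.\<close>

lemma finite_skew_ssyt:
  assumes "is_partition l" "is_partition n"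
  shows "finite (skew_ssyt l m n)"
proof -
  have fin: "finite (skew_diagram l m)"
    using assms(1) by (rule finite_skew_diagram)
  have "skew_ssyt l m n \<subseteq> skew_diagram l m \<rightarrow>\<^sub>E Suc ` {i. n i \<noteq> 0}"
  proof
    fix T assume T: "T \<in> skew_ssyt l m n"
    then have T1: "T \<in> skew_diagram l m \<rightarrow>\<^sub>E {1..}"
      and T2: "\<And>i. card {b \<in> skew_diagram l m. T b = Suc i} = n i"
      by (auto simp: skew_ssyt_def)
    have "T b \<in> Suc ` {i. n i \<noteq> 0}" if b: "b \<in> skew_diagram l m" for b
    proof -
      have "1 \<le> T b" using T1 b by (auto dest: PiE_mem)
      then obtain i where i: "T b = Suc i" by (cases "T b") auto
      have "b \<in> {b \<in> skew_diagram l m. T b = Suc i}" using b i by simp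
      moreover have "finite {b \<in> skew_diagram l m. T b = Suc i}" using fin by simp
      ultimately have "card {b \<in> skew_diagram l m. T b = Suc i} \<noteq> 0"
        using card_0_eq by blast
      then show ?thesis using T2[of i] i by auto
    qed
    then show "T \<in> skew_diagram l m \<rightarrow>\<^sub>E Suc ` {i. n i \<noteq> 0}"
      using T1 by (auto simp: PiE_iff)
  qed
  moreover have "finite (skew_diagram l m \<rightarrow>\<^sub>E Suc ` {i. n i \<noteq> 0})"
    using fin assms(2) by (intro finite_PiE) (auto simp: is_partition_def)
  ultimately show ?thesis by (rule finite_subset)
qed

end

theory Submission imports Defs begin

text \<open>
  The proof rests on a description of the positive skew Kostka numbers by linear inequalities.
  Let \<open>h j\<close> be the number of boxes in column \<open>j\<close> of \<open>l/m\<close>. Then a tableau of shape \<open>l/m\<close>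
  and type \<open>n\<close> exists iff \<open>l/m\<close> is a shape with \<open>\<Sum>j. h j = \<Sum>i. n i\<close> and
  \<open>(\<Sum>i<r. n i) \<le> (\<Sum>j. min r (h j))\<close> for all \<open>r\<close>. In other words, \<open>n\<close> is dominated by
  the conjugate of the partition that lists the column heights (\<open>skew_kostka_pos_iff\<close>).
  Multiplying \<open>l\<close> and \<open>m\<close> by \<open>k\<close> repeats every column \<open>k\<close> times, so both sides of each of these
  relations are multiplied by \<open>k\<close>, and the theorem follows.

  The inequalities are necessary because a column has distinct entries, hence at most
  \<open>min r (h j)\<close> entries among the \<open>r\<close> smallest values. That they suffice is shown by induction
  on the number of parts of \<open>n\<close>: the boxes with the largest entry are to form a horizontal strip
  whose size is the last part of \<open>n\<close>. They are placed at the bottoms of the tallest columns, and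
  of the rightmost ones among columns of equal height. With this choice the boxes left over form
  a skew shape (\<open>remove_horizontal_strip\<close>) that still satisfies the inequalities
  for the remaining parts (\<open>sum_min_decrement_tallest\<close>).
\<close>

section \<open>Column heights\<close>

definition column_height :: "(nat \<Rightarrow> nat) \<Rightarrow> (nat \<Rightarrow> nat) \<Rightarrow> nat \<Rightarrow> nat" where
  "column_height l m j = card {i. (i, j) \<in> skew_diagram l m}"

lemma finite_column:
  assumes "is_partition l"
  shows "finite {i. (i, j) \<in> skew_diagram l m}"
proof -
  have "{i. (i, j) \<in> skew_diagram l m} \<subseteq> {i. l i \<noteq> 0}"
    by (auto simp: skew_diagram_def)
  then show ?thesis
    using assms by (auto simp: is_partition_def intro: finite_subset)
qed

lemma column_height_pos_iff:
  assumes "is_partition l"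
  shows "column_height l m j > 0 \<longleftrightarrow> (\<exists>i. (i, j) \<in> skew_diagram l m)"
  using finite_column[OF assms] by (auto simp: column_height_def card_gt_0_iff)

lemma skew_diagram_column_less:
  assumes "is_partition l" "l 0 \<le> N" "(i, j) \<in> skew_diagram l m"
  shows "j < N"
proof -
  have "l i \<le> l 0" using assms(1) by (auto simp: is_partition_def antimono_def)
  then show ?thesis using assms(2,3) by (auto simp: skew_diagram_def)
qed

lemma card_eq_sum_columns:
  fixes D :: "('a \<times> nat) set"
  assumes "finite D" "\<And>i j. (i, j) \<in> D \<Longrightarrow> j < N"
  shows "card D = (\<Sum>j<N. card {i. (i, j) \<in> D})"
proof -
  have D: "D = prod.swap ` (SIGMA j:{..<N}. {i. (i, j) \<in> D})"
    using assms(2) by (auto simp: image_iff)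
  have "card D = card (SIGMA j:{..<N}. {i. (i, j) \<in> D})"
    by (subst D, rule card_image) (auto simp: inj_on_def)
  also have "\<dots> = (\<Sum>j<N. card {i. (i, j) \<in> D})"
  proof (rule card_SigmaI)
    have "{i. (i, j) \<in> D} \<subseteq> fst ` D" for j by force
    then show "\<forall>j\<in>{..<N}. finite {i. (i, j) \<in> D}"
      using assms(1) by (meson finite_imageI finite_subset)
  qed simp
  finally show ?thesis .
qed

lemma card_skew_diagram:
  assumes "is_partition l" "l 0 \<le> N"
  shows "card (skew_diagram l m) = (\<Sum>j<N. column_height l m j)"
  unfolding column_height_def
  using assms by (intro card_eq_sum_columns finite_skew_diagram skew_diagram_column_less)

section \<open>The inequalities hold for every tableau\<close>

lemma card_entries_le:
  assumes l: "is_partition l" and T: "T \<in> skew_ssyt l m n"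
  shows "card {b \<in> skew_diagram l m. T b \<le> r} = (\<Sum>i<r. n i)"
proof -
  have pos: "T b \<ge> 1" if "b \<in> skew_diagram l m" for b
    using T that by (auto simp: skew_ssyt_def dest: PiE_mem)
  have "{b \<in> skew_diagram l m. T b \<le> r} = (\<Union>i<r. {b \<in> skew_diagram l m. T b = Suc i})"
  proof (intro equalityI subsetI)
    fix b assume b: "b \<in> {b \<in> skew_diagram l m. T b \<le> r}"
    then have "T b = Suc (T b - 1)" using pos[of b] by simp
    then show "b \<in> (\<Union>i<r. {b \<in> skew_diagram l m. T b = Suc i})"
      using b by (intro UN_I[of "T b - 1"]) auto
  qed auto
  also have "card \<dots> = (\<Sum>i<r. card {b \<in> skew_diagram l m. T b = Suc i})"
    using finite_skew_diagram[OF l] by (intro card_UN_disjoint) auto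
  also have "\<dots> = (\<Sum>i<r. n i)"
    using T by (simp add: skew_ssyt_def)
  finally show ?thesis .
qed

lemma tableau_entry_le:
  assumes l: "is_partition l" and T: "T \<in> skew_ssyt l m n"
    and zero: "\<And>i. i \<ge> p \<Longrightarrow> n i = 0" and b: "b \<in> skew_diagram l m"
  shows "T b \<le> p"
proof (rule ccontr)
  assume "\<not> T b \<le> p"
  then obtain i where i: "T b = Suc i" "i \<ge> p" by (cases "T b") auto
  have "card {b \<in> skew_diagram l m. T b = Suc i} = 0"
    using T zero[OF i(2)] by (simp add: skew_ssyt_def)
  moreover have "finite {b \<in> skew_diagram l m. T b = Suc i}"
    using finite_skew_diagram[OF l, of m] by simp
  ultimately have "{b \<in> skew_diagram l m. T b = Suc i} = {}" by (simp only: card_0_eq)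
  then show False using b i(1) by blast
qed

text \<open>The entries of a column are distinct, so at most \<open>r\<close> of them are at most \<open>r\<close>.\<close>

lemma sum_parts_le_sum_min_column_height:
  assumes l: "is_partition l" "l 0 \<le> N" and T: "T \<in> skew_ssyt l m n"
  shows "(\<Sum>i<r. n i) \<le> (\<Sum>j<N. min r (column_height l m j))"
proof -
  let ?D = "{b \<in> skew_diagram l m. T b \<le> r}"
  have "(\<Sum>i<r. n i) = card ?D"
    using card_entries_le[OF l(1) T] by simp
  also have "\<dots> = (\<Sum>j<N. card {i. (i, j) \<in> ?D})"
    using l finite_skew_diagram[OF l(1)]
    by (intro card_eq_sum_columns) (auto intro: skew_diagram_column_less)
  also have "\<dots> \<le> (\<Sum>j<N. min r (column_height l m j))"
  proof (rule sum_mono)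
    fix j
    let ?C = "{i. (i, j) \<in> ?D}"
    have "inj_on (\<lambda>i. T (i, j)) ?C"
    proof (rule linorder_inj_onI')
      fix i i' assume "i \<in> ?C" "i' \<in> ?C" "i < i'"
      then have "T (i, j) < T (i', j)" using T by (auto simp: skew_ssyt_def)
      then show "T (i, j) \<noteq> T (i', j)" by simp
    qed
    moreover have "(\<lambda>i. T (i, j)) ` ?C \<subseteq> {1..r}"
      using T by (auto simp: skew_ssyt_def dest: PiE_mem)
    ultimately have "card ?C \<le> card {1..r}"
      by (rule card_inj_on_le) simp
    moreover have "card ?C \<le> column_height l m j"
      unfolding column_height_def using finite_column[OF l(1)] by (rule card_mono) auto
    ultimately show "card ?C \<le> min r (column_height l m j)" by simp
  qed
  finally show ?thesis .
qed

section \<open>Removing a horizontal strip\<close>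

text \<open>
  The columns of \<open>S\<close> lose their lowest box. The columns whose lowest box is in a given row have
  heights that increase from left to right, because their tops are bounded by the weakly
  decreasing \<open>m\<close>. Hence the closure condition on \<open>S\<close> makes the boxes removed from a row a final
  segment of that row, so that the rest is again a skew shape.
\<close>

lemma remove_horizontal_strip:
  assumes l: "is_partition l" and m: "antimono m" and ml: "\<And>i. m i \<le> l i"
    and S_pos: "\<forall>j\<in>S. column_height l m j > 0"
    and S_closed: "\<forall>j\<in>S. \<forall>j'>j. column_height l m j \<le> column_height l m j' \<longrightarrow> j' \<in> S"
  obtains l' where "is_partition l'" "\<And>i. m i \<le> l' i" "\<And>i. l (Suc i) \<le> l' i" "\<And>i. l' i \<le> l i"
    "\<And>j. column_height l' m j = column_height l m j - (if j \<in> S then 1 else 0)"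
proof -
  define R where "R i = {j. j < l i \<and> \<not> (j \<in> S \<and> l (Suc i) \<le> j)}" for i
  define l' where "l' i = card (R i)" for i
  have l_mono: "l i' \<le> l i" if "i \<le> i'" for i i'
    using l that by (auto simp: is_partition_def antimono_def)
  have below: "i' \<le> i" if "l (Suc i) \<le> j" "j < l i'" for i i' j
    using l_mono[of "Suc i" i'] that by (meson leD le_trans not_less_eq_eq)
  \<comment> \<open>The lowest box of a nonempty column belongs to the diagram.\<close>
  have bottom: "m i \<le> j" if "l (Suc i) \<le> j" "j \<in> S" for i j
  proof -
    from bspec[OF S_pos \<open>j \<in> S\<close>] obtain i' where i': "m i' \<le> j" "j < l i'"
      by (auto simp: column_height_pos_iff[OF l] skew_diagram_def)
    have "i' \<le> i" using below[OF that(1) i'(2)] .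
    then have "m i \<le> m i'" using m by (auto simp: antimono_def)
    then show ?thesis using i' by simp
  qed
  have R_down: "j \<in> R i" if "j' \<in> R i" "j < j'" for i j j'
  proof (rule ccontr)
    assume "j \<notin> R i"
    then have j: "j \<in> S" "l (Suc i) \<le> j" using that by (auto simp: R_def)
    have "{i'. (i', j) \<in> skew_diagram l m} \<subseteq> {i'. (i', j') \<in> skew_diagram l m}"
    proof safe
      fix i' assume i': "(i', j) \<in> skew_diagram l m"
      then have "i' \<le> i" using below[OF j(2)] by (auto simp: skew_diagram_def)
      then have "j' < l i'" using l_mono[of i' i] that by (auto simp: R_def)
      then show "(i', j') \<in> skew_diagram l m" using i' that by (auto simp: skew_diagram_def)
    qed
    then have "column_height l m j \<le> column_height l m j'"
      unfolding column_height_def using finite_column[OF l] by (rule card_mono[rotated])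
    then have "j' \<in> S" using S_closed j that by blast
    then show False using that j by (auto simp: R_def)
  qed
  have R_eq: "R i = {..<l' i}" for i
  proof -
    have fin: "finite (R i)" by (rule finite_subset[of _ "{..<l i}"]) (auto simp: R_def)
    have "\<exists>a. R i = {..<a}"
    proof (cases "R i = {}")
      case True
      then show ?thesis by (intro exI[of _ 0]) auto
    next
      case False
      then have "Max (R i) \<in> R i" using fin by simp
      then have "j \<in> R i \<longleftrightarrow> j < Suc (Max (R i))" for j
        using R_down[of "Max (R i)" i j] Max_ge[OF fin, of j] by (metis less_Suc_eq_le nat_less_le)
      then have "R i = {..<Suc (Max (R i))}" by blast
      then show ?thesis by blast
    qed
    then show ?thesis unfolding l'_def by (metis card_lessThan)
  qed
  have l'_iff: "j < l' i \<longleftrightarrow> j < l i \<and> \<not> (j \<in> S \<and> l (Suc i) \<le> j)" for i j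
    using R_eq[of i] by (auto simp: R_def set_eq_iff)
  have upper: "l' i \<le> l i" for i
    using l'_iff[of "l i" i] by auto
  have lower: "l (Suc i) \<le> l' i" for i
    using l'_iff[of "l' i" i] l_mono[of i "Suc i"] by auto
  have ml': "m i \<le> l' i" for i
    using l'_iff[of "l' i" i] bottom[of i "l' i"] ml[of i] by auto
  have "is_partition l'"
    unfolding is_partition_def
  proof
    show "antimono l'"
      unfolding antimono_iff_le_Suc using upper lower le_trans by blast
    have "{i. l' i \<noteq> 0} \<subseteq> {i. l i \<noteq> 0}" using upper by (metis (mono_tags) Collect_mono le_zero_eq)
    then show "finite {i. l' i \<noteq> 0}" using l by (auto simp: is_partition_def intro: finite_subset)
  qed
  moreover have "column_height l' m j = column_height l m j - (if j \<in> S then 1 else 0)" for j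
  proof (cases "j \<in> S")
    case False
    then show ?thesis by (simp add: column_height_def skew_diagram_def l'_iff)
  next
    case True
    let ?C = "{i. (i, j) \<in> skew_diagram l m}"
    let ?B = "{i. j < l i}"
    have finB: "finite ?B"
      by (rule finite_subset[of _ "{i. l i \<noteq> 0}"]) (use l in \<open>auto simp: is_partition_def\<close>)
    have "?C \<noteq> {}" using bspec[OF S_pos True] by (auto simp: column_height_pos_iff[OF l])
    then have "?B \<noteq> {}" by (auto simp: skew_diagram_def)
    define i0 where "i0 = Max ?B"
    have i0: "j < l i0" using Max_in[OF finB \<open>?B \<noteq> {}\<close>] by (simp add: i0_def)
    have "Suc i0 \<notin> ?B" using Max_ge[OF finB, of "Suc i0"] by (auto simp: i0_def)
    then have i0': "l (Suc i0) \<le> j" by simp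
    have uniq: "i = i0" if "j < l i" "l (Suc i) \<le> j" for i
      using below[OF that(2) i0] below[OF i0' that(1)] by simp
    have "{i. (i, j) \<in> skew_diagram l' m} = ?C - {i0}"
      using True uniq i0' by (auto simp: skew_diagram_def l'_iff)
    moreover have "i0 \<in> ?C" using i0 bottom[OF i0' True] by (auto simp: skew_diagram_def)
    ultimately show ?thesis
      using True finite_column[OF l] by (simp add: column_height_def)
  qed
  ultimately show thesis using that ml' lower upper by blast
qed

text \<open>
  The condition \<open>l (Suc i) \<le> l' i\<close> says that a box of \<open>l/m\<close> with another one below it already
  lies in \<open>l'/m\<close>, so the new largest entry occurs at most once in each column, at its bottom.
\<close>

lemma extend_tableau_by_horizontal_strip:
  assumes l: "is_partition l" "is_partition l'"
    and ml': "\<And>i. m i \<le> l' i" and l'l: "\<And>i. l' i \<le> l i" and strip: "\<And>i. l (Suc i) \<le> l' i"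
    and T: "T \<in> skew_ssyt l' m (n(p := 0))"
    and zero: "\<And>i. i \<ge> Suc p \<Longrightarrow> n i = 0"
    and size: "card (skew_diagram l m) = card (skew_diagram l' m) + n p"
  shows "(\<lambda>b. if b \<in> skew_diagram l m - skew_diagram l' m then Suc p else T b) \<in> skew_ssyt l m n"
proof -
  let ?D = "skew_diagram l m" and ?D' = "skew_diagram l' m"
  let ?T = "\<lambda>b. if b \<in> ?D - ?D' then Suc p else T b"
  have sub: "?D' \<subseteq> ?D" using l'l by (force simp: skew_diagram_def intro: less_le_trans)
  have T_le: "T b \<le> p" if "b \<in> ?D'" for b
    by (rule tableau_entry_le[OF l(2) T _ that]) (use zero in auto)
  have T_in: "T \<in> ?D' \<rightarrow>\<^sub>E {1..}" using T by (simp add: skew_ssyt_def)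
  have T_row: "T (i, j) \<le> T (i, j')" if "(i, j) \<in> ?D'" "(i, j') \<in> ?D'" "j < j'" for i j j'
    using T that by (simp add: skew_ssyt_def)
  have T_col: "T (i, j) < T (i', j)" if "(i, j) \<in> ?D'" "(i', j) \<in> ?D'" "i < i'" for i i' j
    using T that by (simp add: skew_ssyt_def)
  have T_card: "card {b \<in> ?D'. T b = Suc i} = (n(p := 0)) i" for i
    using T by (simp add: skew_ssyt_def)
  have "?T \<in> ?D \<rightarrow>\<^sub>E {1..}"
    using T_in sub by (auto simp: PiE_iff extensional_def)
  moreover have "\<forall>i. m i \<le> l i" using ml' l'l le_trans by blast
  moreover have "?T (i, j) \<le> ?T (i, j')" if "(i, j) \<in> ?D" "(i, j') \<in> ?D" "j < j'" for i j j'
  proof (cases "(i, j') \<in> ?D'")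
    case True
    then have "(i, j) \<in> ?D'" using that by (auto simp: skew_diagram_def)
    then show ?thesis using True that T_row by simp
  next
    case False
    then show ?thesis using that T_le[of "(i, j)"] by auto
  qed
  moreover have "?T (i, j) < ?T (i', j)" if "(i, j) \<in> ?D" "(i', j) \<in> ?D" "i < i'" for i i' j
  proof -
    have "l i' \<le> l (Suc i)" using l(1) that by (auto simp: is_partition_def antimono_def)
    then have "(i, j) \<in> ?D'"
      using that strip[of i] by (auto simp: skew_diagram_def)
    then show ?thesis using that T_col[of i j i'] T_le[of "(i, j)"] by auto
  qed
  moreover have "card {b \<in> ?D. ?T b = Suc i} = n i" for i
  proof (cases "i = p")
    case True
    then have "{b \<in> ?D. ?T b = Suc i} = ?D - ?D'"
      using T_le by fastforce
    then show ?thesis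
      using True sub size finite_skew_diagram[OF l(2)] by (simp add: card_Diff_subset)
  next
    case False
    then have "{b \<in> ?D. ?T b = Suc i} = {b \<in> ?D'. T b = Suc i}"
      using sub by auto
    then show ?thesis using T_card[of i] False by simp
  qed
  ultimately show ?thesis by (simp add: skew_ssyt_def)
qed

section \<open>The inequalities suffice\<close>

lemma obtain_subset_of_greatest:
  fixes key :: "'a \<Rightarrow> nat"
  assumes "finite A" "c \<le> card A"
  obtains S where "S \<subseteq> A" "card S = c" "\<And>x y. x \<in> S \<Longrightarrow> y \<in> A - S \<Longrightarrow> key y \<le> key x"
proof -
  have "\<exists>S\<subseteq>A. card S = c \<and> (\<forall>x\<in>S. \<forall>y\<in>A - S. key y \<le> key x)"
    using assms(2)
  proof (induction c)
    case 0
    then show ?case by (intro exI[of _ "{}"]) auto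
  next
    case (Suc c)
    then obtain S where S: "S \<subseteq> A" "card S = c" "\<forall>x\<in>S. \<forall>y\<in>A - S. key y \<le> key x" by auto
    have fin: "finite (A - S)" "finite S" using assms(1) S(1) finite_subset by auto
    have "A - S \<noteq> {}" using Suc.prems S(1,2) card_mono[OF fin(2), of A] by auto
    then have "Max (key ` (A - S)) \<in> key ` (A - S)" using fin(1) by (intro Max_in) auto
    then obtain a where a: "a \<in> A - S" "key a = Max (key ` (A - S))" by auto
    have "key y \<le> key a" if "y \<in> A - S" for y
      using a(2) that fin(1) by simp
    then have "\<forall>x\<in>insert a S. \<forall>y\<in>A - insert a S. key y \<le> key x" using S(3) by auto
    moreover have "insert a S \<subseteq> A" "card (insert a S) = Suc c" using S a fin by auto
    ultimately show ?case by blast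
  qed
  then show thesis using that by blast
qed

text \<open>
  If every chosen value exceeds \<open>r\<close>, then truncation at \<open>r\<close> does not see the decrement. Otherwise
  all values outside \<open>S\<close> are at most \<open>r\<close>, so truncation at \<open>r\<close> after the decrement amounts to
  truncation at \<open>Suc r\<close> before it, up to the subtraction of \<open>1\<close> on \<open>S\<close>.
\<close>

lemma sum_min_decrement_tallest:
  fixes h :: "'a \<Rightarrow> nat"
  assumes "finite A" "S \<subseteq> A" "\<And>x. x \<in> S \<Longrightarrow> h x > 0"
    and greatest: "\<And>x y. x \<in> S \<Longrightarrow> y \<in> A - S \<Longrightarrow> h y \<le> h x"
  defines "h' \<equiv> \<lambda>x. h x - (if x \<in> S then 1 else 0)"
  shows "(\<Sum>x\<in>A. min r (h' x)) = (\<Sum>x\<in>A. min r (h x)) \<or>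
    (\<Sum>x\<in>A. min r (h' x)) + card S = (\<Sum>x\<in>A. min (Suc r) (h x))"
proof (cases "\<forall>x\<in>S. h x > r")
  case True
  then have "(\<Sum>x\<in>A. min r (h' x)) = (\<Sum>x\<in>A. min r (h x))"
    by (intro sum.cong) (auto simp: h'_def)
  then show ?thesis ..
next
  case False
  then obtain x where x: "x \<in> S" "h x \<le> r" by auto
  have "h y \<le> r" if "y \<in> A - S" for y
    using greatest[OF x(1) that] x(2) by simp
  then have "min (Suc r) (h y) = min r (h' y) + (if y \<in> S then 1 else 0)" if "y \<in> A" for y
    using assms(3)[of y] that by (fastforce simp: h'_def)
  then have "(\<Sum>y\<in>A. min (Suc r) (h y)) = (\<Sum>y\<in>A. min r (h' y) + (if y \<in> S then 1 else 0))"
    by (intro sum.cong) auto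
  also have "\<dots> = (\<Sum>y\<in>A. min r (h' y)) + card S"
    using assms(1,2) by (simp add: sum.distrib sum.If_cases Int_absorb1)
  finally show ?thesis by simp
qed

text \<open>
  The shape shrinks during the induction, while the sums keep ranging over the same \<open>N\<close> columns;
  this is why \<open>N\<close> is only an upper bound for \<open>l 0\<close>.
\<close>

lemma skew_ssyt_nonempty:
  assumes "is_partition l" "antimono m" "\<And>i. m i \<le> l i" "l 0 \<le> N"
    and "antimono n" "\<And>i. i \<ge> p \<Longrightarrow> n i = 0"
    and "(\<Sum>i<p. n i) = (\<Sum>j<N. column_height l m j)"
    and "\<And>r. r \<le> p \<Longrightarrow> (\<Sum>i<r. n i) \<le> (\<Sum>j<N. min r (column_height l m j))"
  shows "skew_ssyt l m n \<noteq> {}"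
  using assms
proof (induction p arbitrary: l n)
  case 0
  have "card (skew_diagram l m) = 0"
    using 0 card_skew_diagram[of l N m] by simp
  then have empty: "skew_diagram l m = {}"
    using finite_skew_diagram[of l m] 0 by auto
  have "(\<lambda>_. undefined) \<in> skew_ssyt l m n"
    using 0 by (simp add: skew_ssyt_def empty)
  then show ?case by blast
next
  case (Suc p)
  note l = \<open>is_partition l\<close> and lN = \<open>l 0 \<le> N\<close>
  note zero = Suc.prems(6) and total = Suc.prems(7) and dom = Suc.prems(8)
  let ?h = "column_height l m"
  have n_mono: "n i' \<le> n i" if "i \<le> i'" for i i'
    using \<open>antimono n\<close> that by (auto simp: antimono_def)
  let ?A = "{j. j < N \<and> ?h j > 0}"
  \<comment> \<open>There are enough nonempty columns, by the inequality for \<open>r = 1\<close>.\<close>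
  have "n p \<le> n 0" by (rule n_mono) simp
  also have "\<dots> \<le> (\<Sum>j<N. min 1 (?h j))" using dom[of 1] by simp
  also have "\<dots> = (\<Sum>j<N. if ?h j > 0 then 1 else 0)" by (intro sum.cong) auto
  also have "\<dots> = card ?A" by (simp add: sum.If_cases Int_def)
  finally have "n p \<le> card ?A" .
  \<comment> \<open>For \<open>j < N\<close> this key orders the columns by height first and by position second.\<close>
  moreover define key where "key j = ?h j * N + j" for j
  ultimately obtain S where S: "S \<subseteq> ?A" "card S = n p"
      and S_key: "\<And>j j'. j \<in> S \<Longrightarrow> j' \<in> ?A - S \<Longrightarrow> key j' \<le> key j"
    using obtain_subset_of_greatest[of ?A "n p" key] by auto
  have S_greatest: "?h j' \<le> ?h j" if "j \<in> S" "j' \<in> {..<N} - S" for j j'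
  proof (cases "?h j' > 0")
    case True
    then have "key j' \<le> key j" using S_key that by auto
    moreover have "j < N" using S that by auto
    ultimately have "?h j' * N < Suc (?h j) * N" by (simp add: key_def)
    then show ?thesis by (metis less_Suc_eq_le mult_less_cancel2)
  qed simp
  have S_closed: "j' \<in> S" if "j \<in> S" "j < j'" "?h j \<le> ?h j'" for j j'
  proof (rule ccontr)
    assume "j' \<notin> S"
    have pos: "?h j' > 0" using S that by auto
    then have "j' < N"
      using skew_diagram_column_less[OF l lN] by (auto simp: column_height_pos_iff[OF l])
    then have "key j' \<le> key j" using S_key[OF that(1)] \<open>j' \<notin> S\<close> pos by auto
    moreover have "?h j * N \<le> ?h j' * N" using that by simp
    ultimately show False using that unfolding key_def by linarith
  qed
  have S_pos: "?h j > 0" if "j \<in> S" for j using S that by auto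
  have "\<forall>j\<in>S. ?h j > 0" "\<forall>j\<in>S. \<forall>j'>j. ?h j \<le> ?h j' \<longrightarrow> j' \<in> S"
    using S_pos S_closed by blast+
  from remove_horizontal_strip[OF l \<open>antimono m\<close> Suc.prems(3) this]
  obtain l' where l': "is_partition l'" "\<And>i. m i \<le> l' i" "\<And>i. l (Suc i) \<le> l' i" "\<And>i. l' i \<le> l i"
      and h': "\<And>j. column_height l' m j = ?h j - (if j \<in> S then 1 else 0)"
    by blast
  have l'N: "l' 0 \<le> N" using l'(4)[of 0] lN by simp
  have SN: "S \<subseteq> {..<N}" using S by auto
  have "(\<Sum>j<N. ?h j) = (\<Sum>j<N. column_height l' m j + (if j \<in> S then 1 else 0))"
    using S_pos by (intro sum.cong) (auto simp: h' Suc_leI)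
  also have "\<dots> = (\<Sum>j<N. column_height l' m j) + n p"
    using SN S(2) by (simp add: sum.distrib sum.If_cases Int_absorb1)
  finally have sum_h: "(\<Sum>j<N. ?h j) = (\<Sum>j<N. column_height l' m j) + n p" .
  have "skew_ssyt l' m (n(p := 0)) \<noteq> {}"
  proof (rule Suc.IH[OF l'(1) \<open>antimono m\<close> l'(2) l'N])
    show "antimono (n(p := 0))"
      unfolding antimono_iff_le_Suc using n_mono zero by auto
    show "(n(p := 0)) i = 0" if "i \<ge> p" for i
      using that zero by auto
    show "(\<Sum>i<p. (n(p := 0)) i) = (\<Sum>j<N. column_height l' m j)"
      using total sum_h by simp
    show "(\<Sum>i<r. (n(p := 0)) i) \<le> (\<Sum>j<N. min r (column_height l' m j))" if "r \<le> p" for r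
    proof -
      have "(\<Sum>j<N. min r (column_height l' m j)) = (\<Sum>j<N. min r (?h j)) \<or>
        (\<Sum>j<N. min r (column_height l' m j)) + n p = (\<Sum>j<N. min (Suc r) (?h j))"
        using sum_min_decrement_tallest[where r = r, OF finite_lessThan SN S_pos S_greatest]
        by (simp add: h' S(2))
      moreover have "(\<Sum>i<r. (n(p := 0)) i) = (\<Sum>i<r. n i)"
        using that by (intro sum.cong) auto
      \<comment> \<open>This is where the parts have to decrease: the removed part is the smallest.\<close>
      moreover have "n p \<le> n r" using that by (rule n_mono)
      ultimately show ?thesis
        using dom[of r] dom[of "Suc r"] that by (auto simp: sum.lessThan_Suc)
    qed
  qed
  then obtain T where T: "T \<in> skew_ssyt l' m (n(p := 0))" by blast
  have "card (skew_diagram l m) = card (skew_diagram l' m) + n p"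
    using sum_h by (simp add: card_skew_diagram[OF l lN] card_skew_diagram[OF l'(1) l'N])
  then show ?case
    using extend_tableau_by_horizontal_strip[OF l l'(1,2,4,3) T zero] by blast
qed

section \<open>The criterion and its invariance under scaling\<close>

lemma skew_kostka_pos_iff:
  assumes l: "is_partition l" "l 0 \<le> N" and m: "is_partition m"
    and n: "is_partition n" "\<And>i. i \<ge> p \<Longrightarrow> n i = 0"
  shows "skew_kostka l m n > 0 \<longleftrightarrow>
    (\<forall>i. m i \<le> l i) \<and> (\<Sum>i<p. n i) = (\<Sum>j<N. column_height l m j) \<and>
    (\<forall>r\<le>p. (\<Sum>i<r. n i) \<le> (\<Sum>j<N. min r (column_height l m j)))"
    (is "_ \<longleftrightarrow> ?criterion")
proof -
  have "?criterion" if T: "T \<in> skew_ssyt l m n" for T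
  proof (intro conjI allI impI)
    show "m i \<le> l i" for i using T by (simp add: skew_ssyt_def)
    have "{b \<in> skew_diagram l m. T b \<le> p} = skew_diagram l m"
      using tableau_entry_le[OF l(1) T n(2)] by auto
    then show "(\<Sum>i<p. n i) = (\<Sum>j<N. column_height l m j)"
      using card_entries_le[OF l(1) T, of p] card_skew_diagram[OF l, of m] by simp
  qed (rule sum_parts_le_sum_min_column_height[OF l T])
  moreover have "skew_ssyt l m n \<noteq> {}" if ?criterion
    using that l m n by (intro skew_ssyt_nonempty[where N = N and p = p]) (auto simp: is_partition_def)
  moreover have "skew_kostka l m n > 0 \<longleftrightarrow> skew_ssyt l m n \<noteq> {}"
    using finite_skew_ssyt[OF l(1) n(1)] by (simp add: skew_kostka_def card_gt_0_iff)
  ultimately show ?thesis by (metis (no_types, lifting) ex_in_conv)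
qed

lemma is_partition_scale_partition:
  assumes "is_partition l"
  shows "is_partition (scale_partition k l)"
proof -
  have "{i. k * l i \<noteq> 0} \<subseteq> {i. l i \<noteq> 0}" by auto
  then show ?thesis
    using assms by (auto simp: is_partition_def scale_partition_def antimono_def intro: finite_subset)
qed

lemma column_height_scale_partition:
  assumes "k > 0"
  shows "column_height (scale_partition k l) (scale_partition k m) j = column_height l m (j div k)"
  using assms
  by (simp add: column_height_def skew_diagram_def scale_partition_def
      less_eq_div_iff_mult_less_eq div_less_iff_less_mult mult.commute)

lemma sum_div_eq:
  fixes f :: "nat \<Rightarrow> nat"
  assumes "k > 0"
  shows "(\<Sum>j<k * N. f (j div k)) = k * (\<Sum>j<N. f j)"
proof -
  have "(\<Sum>j<k * N. f (j div k)) = (\<Sum>q<N. \<Sum>j\<in>{q * k..<q * k + k}. f (j div k))"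
    by (simp add: sum.nat_group mult.commute)
  also have "\<dots> = (\<Sum>q<N. \<Sum>j\<in>{q * k..<q * k + k}. f q)"
    by (intro sum.cong refl arg_cong[where f = f] div_nat_eqI) (auto simp: mult.commute)
  finally show ?thesis by (simp add: sum_distrib_left)
qed

theorem theorem1:
  fixes lam mu nu :: "nat \<Rightarrow> nat" and k :: nat
  assumes "is_partition lam" and "is_partition mu" and "is_partition nu"
    and "k \<ge> 1"
  shows "skew_kostka (scale_partition k lam) (scale_partition k mu) (scale_partition k nu) > 0
    \<longleftrightarrow> skew_kostka lam mu nu > 0"
proof -
  have k: "k > 0" using assms(4) by simp
  have "finite {i. nu i \<noteq> 0}" using assms(3) by (simp add: is_partition_def)
  then obtain p where "\<forall>i\<in>{i. nu i \<noteq> 0}. i < p" by (auto simp: finite_nat_set_iff_bounded)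
  then have p: "nu i = 0" if "i \<ge> p" for i using that by force
  let ?h = "column_height lam mu"
  have "skew_kostka (scale_partition k lam) (scale_partition k mu) (scale_partition k nu) > 0 \<longleftrightarrow>
    (\<forall>i. k * mu i \<le> k * lam i) \<and>
    (\<Sum>i<p. k * nu i) = (\<Sum>j<k * lam 0. ?h (j div k)) \<and>
    (\<forall>r\<le>p. (\<Sum>i<r. k * nu i) \<le> (\<Sum>j<k * lam 0. min r (?h (j div k))))"
    using skew_kostka_pos_iff[of "scale_partition k lam" "k * lam 0" "scale_partition k mu"
        "scale_partition k nu" p] assms(1-3) p
    by (simp add: is_partition_scale_partition column_height_scale_partition[OF k])
       (simp add: scale_partition_def)
  also have "\<dots> \<longleftrightarrow> (\<forall>i. mu i \<le> lam i) \<and> (\<Sum>i<p. nu i) = (\<Sum>j<lam 0. ?h j) \<and>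
    (\<forall>r\<le>p. (\<Sum>i<r. nu i) \<le> (\<Sum>j<lam 0. min r (?h j)))"
    using k by (simp add: sum_div_eq[of k ?h] sum_div_eq[of k "\<lambda>j. min _ (?h j)"]
        flip: sum_distrib_left)
  also have "\<dots> \<longleftrightarrow> skew_kostka lam mu nu > 0"
    using skew_kostka_pos_iff[OF assms(1) order_refl assms(2,3) p] by simp
  finally show ?thesis .
qed

end
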